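(* For any integer $n\geq 3$, there are no $n$-flimsy connectivity spaces.
   Context: A connectivity space is a pair $(X,\mathcal{C})$ where $X$ is a set and $\mathcal{C}$ is a set of subsets of $X$ such that: (C1) for any $x\in X$, $\{x\}\in\mathcal{C}$; (C2) for any $C\subseteq\mathcal{C}$, if $\bigcap C\neq\varnothing$ then $\bigcup C\in\mathcal{C}$ (in particular, by convention, $\varnothing\in\mathcal{C}$); (C3) for any $Y\in\mathcal{C}$ and any $x,y\in Y$, the subset $C:=\bigcup\{Z\in\mathcal{C} : y\in Z \text{ and } Z\subseteq Y\setminus\{x\}\}$ satisfies $Y\setminus C\in\mathcal{C}$; (C4) for any non-empty $A,B\in\mathcal{C}$ such that $A\cup B\in\mathcal{C}$, at least one of the following holds: (i) there exists $x\in A\cup B$ such that $A\cup\{x\}\in\mathcal{C}$ and $B\cup\{x\}\in\mathcal{C}$; or (ii) there exists $S\in\mathcal{C}$ with $S\subseteq A\cup B$ such that $S\cap A\notin\mathcal{C}$ or $S\cap B\notin\mathcal{C}$. For $n\in\mathbb{N}$, a connectivity space $(X,\mathcal{C})$ is $n$-flimsy if $|X|>n$ and if, for any $S\subseteq X$, $X\setminus S\in\mathcal{C}$ whenever $|S|<n$ and $X\setminus S\notin\mathcal{C}$ whenever $|S|=n$. *)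

theory Defs
  imports Main
begin

text \<open>
  In \<open>union_connected\<close> the family \<open>\<D>\<close> may be empty: since \<open>\<Inter>{} = UNIV\<close>, the axiom then yields
  \<open>{} \<in> \<C>\<close>, which is the convention made in the paper (see \<open>empty_connected\<close> below).
\<close>

locale connectivity_space =
  fixes X :: "'a set" and \<C> :: "'a set set"
  assumes connected_subset: "\<C> \<subseteq> Pow X"
    and singleton_connected: "\<forall>x\<in>X. {x} \<in> \<C>"
    and union_connected: "\<forall>\<D>. \<D> \<subseteq> \<C> \<longrightarrow> \<Inter>\<D> \<noteq> {} \<longrightarrow> \<Union>\<D> \<in> \<C>"
    and complement_connected:
      "\<forall>Y\<in>\<C>. \<forall>x\<in>Y. \<forall>y\<in>Y. Y - \<Union>{Z \<in> \<C>. y \<in> Z \<and> Z \<subseteq> Y - {x}} \<in> \<C>"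
    and touching:
      "\<forall>A\<in>\<C>. \<forall>B\<in>\<C>. A \<noteq> {} \<longrightarrow> B \<noteq> {} \<longrightarrow> A \<union> B \<in> \<C> \<longrightarrow>
        (\<exists>x\<in>A \<union> B. A \<union> {x} \<in> \<C> \<and> B \<union> {x} \<in> \<C>) \<or>
        (\<exists>S\<in>\<C>. S \<subseteq> A \<union> B \<and> (S \<inter> A \<notin> \<C> \<or> S \<inter> B \<notin> \<C>))"
begin

lemma empty_connected: "{} \<in> \<C>"
  using union_connected[rule_format, of "{}"] by simp

end

text \<open>
  The set \<open>X\<close> may be infinite, and \<open>card\<close> is \<open>0\<close> on infinite sets; hence the explicit finiteness
  conditions in the renderings of \<open>|X| > n\<close>, \<open>|S| < n\<close> and \<open>|S| = n\<close>.
\<close>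

definition flimsy :: "nat \<Rightarrow> 'a set \<Rightarrow> 'a set set \<Rightarrow> bool" where
  "flimsy n X \<C> \<longleftrightarrow>
    (infinite X \<or> n < card X) \<and>
    (\<forall>S\<subseteq>X. (finite S \<and> card S < n \<longrightarrow> X - S \<in> \<C>) \<and>
            (finite S \<and> card S = n \<longrightarrow> X - S \<notin> \<C>))"

end

theory Submission
  imports Defs
begin

text \<open>
  Deleting \<open>n - 3\<close> points from an \<open>n\<close>-flimsy space leaves a \<open>3\<close>-flimsy one, so it suffices to
  exclude \<open>n = 3\<close>.

  The main tool is \<open>insert_connected\<close>: in a \<open>3\<close>-flimsy space, if \<open>K\<close> is a component of
  \<open>X - {a, b, c}\<close>, then each of \<open>K \<union> {a}\<close>, \<open>K \<union> {b}\<close> and \<open>K \<union> {c}\<close> is connected. It rests on the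
  fact that the complement of a component of \<open>Y - {x}\<close> in a connected \<open>Y\<close> is connected.

  Now let \<open>C1\<close>, \<open>C2\<close> be two components of \<open>X - {a, x, y}\<close>, with \<open>a, x, y\<close> distinct, and let \<open>z \<in> C1\<close>. The sets
  \<open>X - {x, y, z}\<close>, \<open>X - {a, x, z}\<close> and \<open>X - {a, y, z}\<close> have components \<open>D\<close>, \<open>G\<close> and \<open>H\<close> respectively
  such that \<open>C2\<close>, \<open>D\<close> and \<open>G \<union> H\<close> are pairwise disjoint and \<open>D \<subseteq> C1\<close>; together with \<open>C2\<close> these sets
  look like the faces of a tetrahedron with vertices \<open>a, x, y, z\<close>. Take \<open>p \<in> C2\<close> and \<open>d \<in> D\<close>. The
  set \<open>G \<union> H \<union> {x, y, z}\<close> is connected and avoids \<open>a, p, d\<close>, so that some component \<open>Q\<close> of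
  \<open>X - {a, p, d}\<close> avoids \<open>x, y, z\<close>. Then \<open>Q \<union> {p, d}\<close> is connected and avoids \<open>a, x, y\<close>, although
  \<open>p\<close> and \<open>d\<close> lie in different components of \<open>X - {a, x, y}\<close>.
\<close>

section \<open>Components in a connectivity space\<close>

context connectivity_space
begin

text \<open>\<open>component K V\<close>: the set \<open>K\<close> is a connected component of \<open>V\<close>, that is, a nonempty connected
  subset of \<open>V\<close> which contains every connected subset of \<open>V\<close> that it meets.\<close>

definition component :: "'a set \<Rightarrow> 'a set \<Rightarrow> bool" where
  "component K V \<longleftrightarrow>
    K \<in> \<C> \<and> K \<noteq> {} \<and> K \<subseteq> V \<and> (\<forall>Z\<in>\<C>. Z \<subseteq> V \<longrightarrow> Z \<inter> K \<noteq> {} \<longrightarrow> Z \<subseteq> K)"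

lemma Union_connected:
  assumes "\<D> \<subseteq> \<C>" and "\<And>Z. Z \<in> \<D> \<Longrightarrow> p \<in> Z"
  shows "\<Union>\<D> \<in> \<C>"
  using union_connected assms by blast

lemma Un_connected:
  assumes "A \<in> \<C>" "B \<in> \<C>" "A \<inter> B \<noteq> {}"
  shows "A \<union> B \<in> \<C>"
  using union_connected[rule_format, of "{A, B}"] assms by simp

lemma component_connected: "component K V \<Longrightarrow> K \<in> \<C>"
  and component_nonempty: "component K V \<Longrightarrow> K \<noteq> {}"
  and component_subset: "component K V \<Longrightarrow> K \<subseteq> V"
  unfolding component_def by auto

lemma component_maximal:
  assumes "component K V" "Z \<in> \<C>" "Z \<subseteq> V" "Z \<inter> K \<noteq> {}"
  shows "Z \<subseteq> K"
  using assms unfolding component_def by blast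

lemma component_Union:
  assumes "V \<subseteq> X" "v \<in> V"
  shows "component (\<Union>{Z \<in> \<C>. v \<in> Z \<and> Z \<subseteq> V}) V" (is "component ?K V")
    and "v \<in> \<Union>{Z \<in> \<C>. v \<in> Z \<and> Z \<subseteq> V}"
proof -
  show v: "v \<in> ?K"
    using singleton_connected assms by blast
  have K: "?K \<in> \<C>"
    by (rule Union_connected[of _ v]) auto
  have "Z \<subseteq> ?K" if Z: "Z \<in> \<C>" "Z \<subseteq> V" "Z \<inter> ?K \<noteq> {}" for Z
  proof -
    have "Z \<union> ?K \<in> \<C>"
      using Un_connected Z K by blast
    moreover have "Z \<union> ?K \<subseteq> V" "v \<in> Z \<union> ?K"
      using Z v by auto
    ultimately show ?thesis
      by blast
  qed
  then show "component ?K V"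
    unfolding component_def using K v by blast
qed

lemma ex_component:
  assumes "V \<subseteq> X" "v \<in> V"
  obtains K where "component K V" "v \<in> K"
  using component_Union[OF assms] by blast

lemma component_eq_Union:
  assumes "component K V" "y \<in> K"
  shows "K = \<Union>{Z \<in> \<C>. y \<in> Z \<and> Z \<subseteq> V}"
  using assms unfolding component_def by blast

lemma Diff_component_connected:
  assumes "Y \<in> \<C>" "x \<in> Y" "component K (Y - {x})"
  shows "Y - K \<in> \<C>"
proof -
  obtain y where y: "y \<in> K"
    using component_nonempty assms(3) by blast
  then have "y \<in> Y"
    using component_subset assms(3) by blast
  then show ?thesis
    using complement_connected assms(1,2) component_eq_Union[OF assms(3) y] by simp
qed

lemma ex_disjoint_component:
  assumes "V \<subseteq> X" "V \<notin> \<C>" "Z \<in> \<C>" "Z \<subseteq> V" "Z \<noteq> {}"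
  obtains K where "component K V" "K \<inter> Z = {}"
proof -
  obtain z where z: "z \<in> Z"
    using assms by blast
  then obtain L where L: "component L V" "z \<in> L"
    using ex_component assms by blast
  have ZL: "Z \<subseteq> L"
    using component_maximal[OF L(1)] assms z L(2) by blast
  have "L \<noteq> V"
    using component_connected[OF L(1)] assms(2) by blast
  then obtain v where v: "v \<in> V" "v \<notin> L"
    using component_subset[OF L(1)] by blast
  then obtain K where K: "component K V" "v \<in> K"
    using ex_component assms(1) by blast
  have "K \<inter> L = {}"
    using component_maximal[OF L(1) component_connected[OF K(1)] component_subset[OF K(1)]] K v
    by blast
  then show ?thesis
    using that K ZL by blast
qed

text \<open>The space \<open>W\<close> plays the role of a \<open>2\<close>-flimsy space. The complement of \<open>K\<close> in \<open>W - {x}\<close> is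
  connected; hence, for \<open>q \<in> K\<close>, it lies in one component \<open>N\<close> of \<open>W - {q, x}\<close>. The complement of
  \<open>N\<close> in \<open>W - {q}\<close> is then a connected subset of \<open>K \<union> {x}\<close> that contains \<open>x\<close> and meets \<open>K\<close>.\<close>

lemma insert_connected_pair:
  assumes W: "W \<subseteq> X"
    and delete1: "\<And>q. q \<in> W \<Longrightarrow> W - {q} \<in> \<C>"
    and delete2: "\<And>q r. q \<in> W \<Longrightarrow> r \<in> W \<Longrightarrow> q \<noteq> r \<Longrightarrow> W - {q, r} \<notin> \<C>"
    and xy: "x \<in> W" "y \<in> W" "x \<noteq> y"
    and K: "component K (W - {x, y})"
  shows "insert x K \<in> \<C>"
proof -
  obtain q where q: "q \<in> K"
    using component_nonempty[OF K] by blast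
  have KW: "K \<subseteq> W - {x, y}"
    by (rule component_subset[OF K])
  have R: "W - {x} - K \<in> \<C>"
    by (rule Diff_component_connected[of _ y])
      (use K xy delete1 in \<open>auto simp: Diff_insert2[symmetric] insert_commute\<close>)
  obtain N where N: "component N (W - {q} - {x})" "y \<in> N"
    using ex_component[of "W - {q} - {x}" y] W xy q KW by blast
  have RN: "W - {x} - K \<subseteq> N"
    using component_maximal[OF N(1) R] xy q KW N(2) by blast
  have P: "W - {q} - N \<in> \<C>"
    using Diff_component_connected[OF delete1[of q], of x N] N q KW xy by blast
  have "W - {q} - {x} \<noteq> N"
    using delete2[of q x] component_connected[OF N(1)] q KW xy
    by (auto simp: Diff_insert2[symmetric] insert_commute)
  then have meets: "K \<inter> (W - {q} - N) \<noteq> {}"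
    using RN component_subset[OF N(1)] by blast
  have "x \<in> W - {q} - N" "W - {q} - N \<subseteq> insert x K"
    using RN component_subset[OF N(1)] xy q KW by blast+
  then have "insert x K = K \<union> (W - {q} - N)"
    by blast
  then show ?thesis
    using Un_connected[OF component_connected[OF K] P meets] by simp
qed

section \<open>Excluding 3-flimsy spaces\<close>

lemma flimsy3_delete2:
  assumes "flimsy 3 X \<C>" "a \<in> X" "b \<in> X"
  shows "X - {a, b} \<in> \<C>"
  using assms card_insert_le_m1[of 2 "{b}" a] unfolding flimsy_def by auto

lemma flimsy3_delete3:
  assumes "flimsy 3 X \<C>" "a \<in> X" "b \<in> X" "c \<in> X" "a \<noteq> b" "a \<noteq> c" "b \<noteq> c"
  shows "X - {a, b, c} \<notin> \<C>"
proof -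
  have "{a, b, c} \<subseteq> X" "card {a, b, c} = 3"
    using assms by auto
  then show ?thesis
    using assms(1) unfolding flimsy_def by blast
qed

lemma insert_connected:
  assumes fl: "flimsy 3 X \<C>"
    and abc: "a \<in> X" "b \<in> X" "c \<in> X" "a \<noteq> b" "a \<noteq> c" "b \<noteq> c"
    and K: "component K (X - {a, b, c})"
  shows "insert a K \<in> \<C>" "insert b K \<in> \<C>" "insert c K \<in> \<C>"
proof -
  have main: "insert v K \<in> \<C>"
    if "{u, v, w} = {a, b, c}" "u \<noteq> v" "v \<noteq> w" "u \<noteq> w" for u v w
  proof (rule insert_connected_pair[of "X - {u}" v w])
    have "{u, v, w} \<subseteq> X"
      unfolding that(1) using abc by blast
    then have X: "u \<in> X" "v \<in> X" "w \<in> X"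
      by blast+
    show "v \<in> X - {u}" "w \<in> X - {u}" "v \<noteq> w" "X - {u} \<subseteq> X"
      using that(2-4) X by auto
    show "X - {u} - {q} \<in> \<C>" if "q \<in> X - {u}" for q
      using flimsy3_delete2[OF fl, of u q] X(1) that by (simp add: Diff_insert2[symmetric])
    show "X - {u} - {q, r} \<notin> \<C>" if "q \<in> X - {u}" "r \<in> X - {u}" "q \<noteq> r" for q r
    proof -
      have "X - {u} - {q, r} = X - {u, q, r}"
        by blast
      then show ?thesis
        using flimsy3_delete3[OF fl, of u q r] X(1) that by auto
    qed
    have "X - {u} - {v, w} = X - {a, b, c}"
      unfolding that(1)[symmetric] by blast
    then show "component K (X - {u} - {v, w})"
      using K by simp
  qed
  show "insert a K \<in> \<C>" "insert b K \<in> \<C>" "insert c K \<in> \<C>"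
    using abc by (auto intro: main[of b a c] main[of a b c] main[of a c b])
qed

lemma not_flimsy3: "\<not> flimsy 3 X \<C>"
proof
  assume fl: "flimsy 3 X \<C>"
  obtain T where T: "T \<subseteq> X" "card T = 3"
    using fl infinite_arbitrarily_large[of X 3] obtain_subset_with_card_n[of 3 X]
    unfolding flimsy_def by (metis less_imp_le)
  then obtain a x y where axy: "a \<in> X" "x \<in> X" "y \<in> X" "a \<noteq> x" "a \<noteq> y" "x \<noteq> y"
    by (auto simp: card_3_iff)
  have disc: "X - {a, x, y} \<notin> \<C>"
    by (rule flimsy3_delete3[OF fl axy])
  then have "X - {a, x, y} \<noteq> {}"
    using empty_connected by metis
  then obtain C1 where C1: "component C1 (X - {a, x, y})"
    using ex_component[of "X - {a, x, y}"] by blast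
  obtain C2 where C2: "component C2 (X - {a, x, y})" "C2 \<inter> C1 = {}"
    using ex_disjoint_component[of "X - {a, x, y}" C1] disc component_connected[OF C1]
      component_subset[OF C1] component_nonempty[OF C1] by blast
  note C1sub = component_subset[OF C1] and C2sub = component_subset[OF C2(1)]
  note C2ins = insert_connected[OF fl axy C2(1)]
  obtain z where z: "z \<in> C1"
    using component_nonempty[OF C1] by blast
  then have zX: "z \<in> X" "a \<noteq> z" "x \<noteq> z" "y \<noteq> z" "z \<notin> C2"
    using C1sub C2(2) by blast+

  \<comment> \<open>\<open>C2 \<union> {a}\<close> is connected, so a component of \<open>X - {x, y, z}\<close> avoids it; that component also
    avoids \<open>a\<close>, so joining \<open>z\<close> to it places it inside \<open>C1\<close>.\<close>
  obtain D where D: "component D (X - {x, y, z})" "D \<inter> insert a C2 = {}"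
    using ex_disjoint_component[of "X - {x, y, z}" "insert a C2"] axy zX C2sub C2ins
      flimsy3_delete3[OF fl, of x y z] by blast
  note Dsub = component_subset[OF D(1)]
  note Dins = insert_connected[OF fl axy(2,3) zX(1) axy(6) zX(3,4) D(1)]
  have "insert z D \<subseteq> C1"
    by (rule component_maximal[OF C1 Dins(3)]) (use Dsub D(2) zX z axy in blast)+
  then have DC1: "D \<subseteq> C1"
    by blast
  obtain p where p: "p \<in> C2"
    using component_nonempty[OF C2(1)] by blast
  obtain d where d: "d \<in> D"
    using component_nonempty[OF D(1)] by blast

  \<comment> \<open>Joined through \<open>y\<close> (or \<open>x\<close>), \<open>C2\<close> and \<open>D\<close> form a connected set, which misses some component
    of \<open>X - {a, x, z}\<close> (or \<open>X - {a, y, z}\<close>).\<close>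
  have "insert y C2 \<union> insert y D \<in> \<C>" "insert x C2 \<union> insert x D \<in> \<C>"
    by (rule Un_connected; use C2ins Dins in blast)+
  then have CD: "insert y (C2 \<union> D) \<in> \<C>" "insert x (C2 \<union> D) \<in> \<C>"
    by simp_all
  obtain G where G: "component G (X - {a, x, z})" "G \<inter> insert y (C2 \<union> D) = {}"
    using ex_disjoint_component[of "X - {a, x, z}" "insert y (C2 \<union> D)"] axy zX C2sub Dsub D(2) CD
      flimsy3_delete3[OF fl, of a x z] by blast
  obtain H where H: "component H (X - {a, y, z})" "H \<inter> insert x (C2 \<union> D) = {}"
    using ex_disjoint_component[of "X - {a, y, z}" "insert x (C2 \<union> D)"] axy zX C2sub Dsub D(2) CD
      flimsy3_delete3[OF fl, of a y z] by blast
  note Gsub = component_subset[OF G(1)] and Hsub = component_subset[OF H(1)]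
  note Gins = insert_connected[OF fl axy(1,2) zX(1) axy(4) zX(2,3) G(1)]
  note Hins = insert_connected[OF fl axy(1,3) zX(1) axy(5) zX(2,4) H(1)]
  have "insert x G \<union> insert z G \<in> \<C>" "insert y H \<union> insert z H \<in> \<C>"
    using Un_connected Gins Hins component_nonempty G(1) H(1) by blast+
  then have GH: "(insert x G \<union> insert z G) \<union> (insert y H \<union> insert z H) \<in> \<C>" (is "?J \<in> \<C>")
    by (rule Un_connected) blast
  have pd: "p \<in> X" "d \<in> X" "a \<noteq> p" "a \<noteq> d" "p \<noteq> d"
    using p d C2sub Dsub D(2) by blast+
  have "?J \<subseteq> X - {a, p, d}"
    using Gsub Hsub G(2) H(2) p d axy zX C2sub Dsub by blast
  then obtain Q where Q: "component Q (X - {a, p, d})" "Q \<inter> ?J = {}"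
    using ex_disjoint_component[of "X - {a, p, d}" ?J] GH
      flimsy3_delete3[OF fl axy(1) pd] by blast
  note Qins = insert_connected[OF fl axy(1) pd Q(1)]
  have "insert p Q \<union> insert d Q \<in> \<C>"
    using Un_connected Qins component_nonempty[OF Q(1)] by blast
  moreover have "insert p Q \<union> insert d Q \<subseteq> X - {a, x, y}"
    using component_subset[OF Q(1)] Q(2) pd p d C2sub Dsub by blast
  ultimately have "insert p Q \<union> insert d Q \<subseteq> C2"
    using component_maximal[OF C2(1)] p by blast
  then show False
    using d D(2) by blast
qed

section \<open>Deleting points from a flimsy space\<close>

lemma connectivity_space_subspace:
  assumes "W \<subseteq> X"
  shows "connectivity_space W {Z \<in> \<C>. Z \<subseteq> W}"
proof
  show "{Z \<in> \<C>. Z \<subseteq> W} \<subseteq> Pow W"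
    by blast
  show "\<forall>x\<in>W. {x} \<in> {Z \<in> \<C>. Z \<subseteq> W}"
    using singleton_connected assms by blast
  show "\<forall>\<D>. \<D> \<subseteq> {Z \<in> \<C>. Z \<subseteq> W} \<longrightarrow> \<Inter>\<D> \<noteq> {} \<longrightarrow> \<Union>\<D> \<in> {Z \<in> \<C>. Z \<subseteq> W}"
    using union_connected by blast
  show "\<forall>Y\<in>{Z \<in> \<C>. Z \<subseteq> W}. \<forall>x\<in>Y. \<forall>y\<in>Y.
      Y - \<Union>{Z \<in> {Z \<in> \<C>. Z \<subseteq> W}. y \<in> Z \<and> Z \<subseteq> Y - {x}} \<in> {Z \<in> \<C>. Z \<subseteq> W}"
  proof (intro ballI)
    fix Y x y
    assume Y: "Y \<in> {Z \<in> \<C>. Z \<subseteq> W}" "x \<in> Y" "y \<in> Y"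
    then have "{Z \<in> {Z \<in> \<C>. Z \<subseteq> W}. y \<in> Z \<and> Z \<subseteq> Y - {x}} = {Z \<in> \<C>. y \<in> Z \<and> Z \<subseteq> Y - {x}}"
      by blast
    moreover have "Y - \<Union>{Z \<in> \<C>. y \<in> Z \<and> Z \<subseteq> Y - {x}} \<in> \<C>"
      using complement_connected Y by blast
    ultimately show "Y - \<Union>{Z \<in> {Z \<in> \<C>. Z \<subseteq> W}. y \<in> Z \<and> Z \<subseteq> Y - {x}} \<in> {Z \<in> \<C>. Z \<subseteq> W}"
      using Y by auto
  qed
  show "\<forall>A\<in>{Z \<in> \<C>. Z \<subseteq> W}. \<forall>B\<in>{Z \<in> \<C>. Z \<subseteq> W}.
      A \<noteq> {} \<longrightarrow> B \<noteq> {} \<longrightarrow> A \<union> B \<in> {Z \<in> \<C>. Z \<subseteq> W} \<longrightarrow>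
      (\<exists>x\<in>A \<union> B. A \<union> {x} \<in> {Z \<in> \<C>. Z \<subseteq> W} \<and> B \<union> {x} \<in> {Z \<in> \<C>. Z \<subseteq> W}) \<or>
      (\<exists>S\<in>{Z \<in> \<C>. Z \<subseteq> W}. S \<subseteq> A \<union> B \<and>
        (S \<inter> A \<notin> {Z \<in> \<C>. Z \<subseteq> W} \<or> S \<inter> B \<notin> {Z \<in> \<C>. Z \<subseteq> W}))"
  proof (intro ballI impI)
    fix A B
    assume AB: "A \<in> {Z \<in> \<C>. Z \<subseteq> W}" "B \<in> {Z \<in> \<C>. Z \<subseteq> W}" "A \<noteq> {}" "B \<noteq> {}"
      "A \<union> B \<in> {Z \<in> \<C>. Z \<subseteq> W}"
    then have "(\<exists>x\<in>A \<union> B. A \<union> {x} \<in> \<C> \<and> B \<union> {x} \<in> \<C>) \<or>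
        (\<exists>S\<in>\<C>. S \<subseteq> A \<union> B \<and> (S \<inter> A \<notin> \<C> \<or> S \<inter> B \<notin> \<C>))"
      using touching by blast
    then show "(\<exists>x\<in>A \<union> B. A \<union> {x} \<in> {Z \<in> \<C>. Z \<subseteq> W} \<and> B \<union> {x} \<in> {Z \<in> \<C>. Z \<subseteq> W}) \<or>
      (\<exists>S\<in>{Z \<in> \<C>. Z \<subseteq> W}. S \<subseteq> A \<union> B \<and>
        (S \<inter> A \<notin> {Z \<in> \<C>. Z \<subseteq> W} \<or> S \<inter> B \<notin> {Z \<in> \<C>. Z \<subseteq> W}))"
      using AB by blast
  qed
qed

end

lemma flimsy_Diff:
  assumes fl: "flimsy (m + card T) X \<C>" and T: "T \<subseteq> X" "finite T"
  shows "flimsy m (X - T) {Z \<in> \<C>. Z \<subseteq> X - T}"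
proof -
  have "infinite (X - T) \<or> m < card (X - T)"
    using fl T card_Diff_subset[of T X] unfolding flimsy_def by auto
  moreover have "(card S < m \<longrightarrow> X - T - S \<in> \<C>) \<and> (card S = m \<longrightarrow> X - T - S \<notin> \<C>)"
    if S: "S \<subseteq> X - T" "finite S" for S
  proof -
    have "card (T \<union> S) = card T + card S"
      using S T by (intro card_Un_disjoint) auto
    moreover have "T \<union> S \<subseteq> X" "finite (T \<union> S)"
      using S T by auto
    moreover have "X - T - S = X - (T \<union> S)"
      by blast
    ultimately show ?thesis
      using fl unfolding flimsy_def by (metis add.commute add_less_cancel_left)
  qed
  ultimately show ?thesis
    unfolding flimsy_def by blast
qed

theorem theorem3p13:
  fixes n :: nat
  assumes "n \<ge> 3"
  shows "\<not> (\<exists>(X :: 'a set) \<C>. connectivity_space X \<C> \<and> flimsy n X \<C>)"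
proof
  assume "\<exists>(X :: 'a set) \<C>. connectivity_space X \<C> \<and> flimsy n X \<C>"
  then obtain X :: "'a set" and \<C> where X: "connectivity_space X \<C>" "flimsy n X \<C>"
    by blast
  obtain T where T: "T \<subseteq> X" "finite T" "card T = n - 3"
  proof (cases "finite X")
    case True
    then have "n < card X"
      using X(2) unfolding flimsy_def by blast
    then have "n - 3 \<le> card X"
      by linarith
    then show ?thesis
      using that by (rule obtain_subset_with_card_n)
  next
    case False
    then show ?thesis
      using that infinite_arbitrarily_large[of X "n - 3"] by blast
  qed
  have "flimsy 3 (X - T) {Z \<in> \<C>. Z \<subseteq> X - T}"
    by (rule flimsy_Diff) (use X T assms in simp_all)
  moreover have "connectivity_space (X - T) {Z \<in> \<C>. Z \<subseteq> X - T}"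
    using connectivity_space.connectivity_space_subspace[OF X(1)] by blast
  ultimately show False
    using connectivity_space.not_flimsy3 by blast
qed

end
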